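(* For every $\varepsilon>0$ and every integer $n_0$, there exists a simple graph $G$ on $n>n_0$ vertices that contains no $1$-immersion of a complete graph on at least $c^{2-\varepsilon}n$ vertices, where $c=|E(G)|/\binom{n}{2}$.
   Context: All graphs are finite. An immersion of a graph $H$ into a graph $G$ is a one-to-one map $\phi:V(H)\to V(G)$ together with a path $P_{uv}$ in $G$ joining $\phi(u)$ and $\phi(v)$ for each edge $uv\in E(H)$, such that the paths $P_{uv}$, $uv\in E(H)$, are pairwise edge-disjoint. A $1$-immersion is an immersion in which each of the paths $P_{uv}$ has exactly one internal vertex. *)

theory Defs
  imports Complex_Main "HOL-Library.Ramsey" "HOL-Library.Disjoint_Sets"
begin

text \<open>
  A graph is given by its vertex set and its edge set, the edges being two-element sets of
  vertices; \<^term>\<open>nsets V 2\<close> is the set of all two-element subsets of \<^term>\<open>V\<close>.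
\<close>

definition simple_graph :: "'a set \<Rightarrow> 'a set set \<Rightarrow> bool" where
  "simple_graph V E \<longleftrightarrow> finite V \<and> E \<subseteq> nsets V 2"

definition complete_graph :: "'a set \<Rightarrow> 'a set set \<Rightarrow> bool" where
  "complete_graph V E \<longleftrightarrow> finite V \<and> E = nsets V 2"

definition path_edges :: "'a list \<Rightarrow> 'a set set" where
  "path_edges p = {{p ! i, p ! Suc i} |i. Suc i < length p}"

definition is_path :: "'a set \<Rightarrow> 'a set set \<Rightarrow> 'a list \<Rightarrow> bool" where
  "is_path V E p \<longleftrightarrow> p \<noteq> [] \<and> distinct p \<and> set p \<subseteq> V \<and> path_edges p \<subseteq> E"

definition internal_vertices :: "'a list \<Rightarrow> 'a set" where
  "internal_vertices p = set (butlast (tl p))"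

text \<open>
  The paths are indexed by the edges of the immersed graph. These are unordered pairs, so the path
  for the edge \<open>{u, v}\<close> may be listed from either of its two ends \<open>\<phi> u\<close>, \<open>\<phi> v\<close>.
\<close>

definition immersion ::
  "'b set \<Rightarrow> 'b set set \<Rightarrow> 'a set \<Rightarrow> 'a set set \<Rightarrow> ('b \<Rightarrow> 'a) \<Rightarrow> ('b set \<Rightarrow> 'a list) \<Rightarrow> bool" where
  "immersion VH EH VG EG \<phi> P \<longleftrightarrow>
     inj_on \<phi> VH \<and> \<phi> ` VH \<subseteq> VG \<and>
     (\<forall>e\<in>EH. is_path VG EG (P e) \<and> {hd (P e), last (P e)} = \<phi> ` e) \<and>
     disjoint_family_on (\<lambda>e. path_edges (P e)) EH"

definition one_immersion ::
  "'b set \<Rightarrow> 'b set set \<Rightarrow> 'a set \<Rightarrow> 'a set set \<Rightarrow> ('b \<Rightarrow> 'a) \<Rightarrow> ('b set \<Rightarrow> 'a list) \<Rightarrow> bool" where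
  "one_immersion VH EH VG EG \<phi> P \<longleftrightarrow>
     immersion VH EH VG EG \<phi> P \<and> (\<forall>e\<in>EH. card (internal_vertices (P e)) = 1)"

definition edge_density :: "'a set \<Rightarrow> 'a set set \<Rightarrow> real" where
  "edge_density V E = real (card E) / real (card V choose 2)"

end

theory Submission imports Defs begin

text \<open>
  The graph is found by counting. Consider graphs on \<open>n\<close> vertices with exactly \<open>m\<close> edges, so
  that the density \<open>c\<close> is exactly \<open>m / (n choose 2)\<close>, and let \<open>t\<close> be a constant depending only on
  \<open>\<epsilon>\<close>. A 1-immersion of a complete graph on at least \<open>t\<close> vertices restricts to one of \<open>K\<^sub>t\<close>. The
  latter is determined by the \<open>t\<close> images of the vertices and the \<open>t choose 2\<close> middle vertices of the
  paths, and since its paths are edge-disjoint it occupies exactly \<open>2 * (t choose 2)\<close> edges, even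
  when middle vertices coincide with each other or with images of vertices
  (\<open>one_immersion_contains_pattern\<close>). There are thus at most \<open>n ^ (t + (t choose 2))\<close> edge sets to
  avoid, and a given one lies in a proportion of at most \<open>c ^ (2 * (t choose 2))\<close> of all graphs with
  \<open>m\<close> edges (\<open>card_nsets_superset_le\<close>). By the union bound some graph avoids all of them provided
  that \<open>n ^ (t + (t choose 2)) * c ^ (2 * (t choose 2)) < 1\<close>, which means that \<open>c\<close> lies below
  \<open>n powr - (1/2 + 1/(t - 1))\<close>.

  For large \<open>t\<close> this barrier is close to \<open>n powr - (1/2)\<close>, the density at which
  \<open>c powr 2 * n\<close> is of order \<open>1\<close>. The loss of \<open>\<epsilon>\<close> in the exponent leaves room for a choice of \<open>c\<close>
  below the barrier for which \<open>c powr (2 - \<epsilon>) * n\<close> is a small positive power of \<open>n\<close>, and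
  hence exceeds the constant \<open>t\<close> (\<open>ex_density_parameters\<close>).
\<close>

section \<open>A union bound for sets of fixed size\<close>

text \<open>
  This is the probability that a uniformly random \<open>m\<close>-subset of an \<open>N\<close>-set contains \<open>k\<close> given points,
  compared with the value for independent choices: each of its factors
  \<open>(m - i) / (N - i)\<close> is at most \<open>m / N\<close>.
\<close>

lemma binomial_diff_ratio_le:
  fixes N m k :: nat
  assumes "k \<le> m" "m \<le> N"
  shows "real ((N - k) choose (m - k)) \<le> real (N choose m) * (real m / real N) ^ k"
  using assms(1)
proof (induction k)
  case 0
  then show ?case by simp
next
  case (Suc k)
  let ?a = "N - Suc k" and ?b = "m - Suc k"
  have step: "N - k = Suc ?a" "m - k = Suc ?b" using Suc.prems assms(2) by auto
  have "Suc ?b * (Suc ?a choose Suc ?b) = Suc ?a * (?a choose ?b)"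
    by (rule Suc_times_binomial)
  then have "real (Suc ?a) * real (?a choose ?b) = real (Suc ?b) * real (Suc ?a choose Suc ?b)"
    by (metis of_nat_mult)
  then have eq: "real (?a choose ?b) = (real (m - k) / real (N - k)) * real ((N - k) choose (m - k))"
    unfolding step by (simp add: field_simps del: binomial_Suc_Suc)
  have "real (m - k) * real N \<le> real m * real (N - k)"
    using Suc.prems assms(2) mult_left_mono[of "real m" "real N" "real k"]
    by (simp add: algebra_simps)
  then have "real (m - k) / real (N - k) \<le> real m / real N"
    using Suc.prems assms(2) by (simp add: divide_simps)
  then have "real (?a choose ?b) \<le> (real m / real N) * (real (N choose m) * (real m / real N) ^ k)"
    unfolding eq using Suc by (intro mult_mono) auto
  then show ?case by (simp add: algebra_simps)
qed

lemma card_nsets: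
  assumes "finite A"
  shows "card (nsets A k) = card A choose k"
proof -
  have "nsets A k = {B. B \<subseteq> A \<and> card B = k}"
    using assms by (auto simp: nsets_def finite_subset)
  then show ?thesis using n_subsets[OF assms] by simp
qed

lemma card_nsets_superset_le:
  fixes U X :: "'a set"
  assumes "finite U" "X \<subseteq> U" "m \<le> card U"
  shows "real (card {Y \<in> nsets U m. X \<subseteq> Y}) \<le> real (card U choose m) * (real m / real (card U)) ^ card X"
proof (cases "card X \<le> m")
  case True
  have fX: "finite X" using assms finite_subset by blast
  have "inj_on (\<lambda>Y. Y - X) {Y \<in> nsets U m. X \<subseteq> Y}"
    by (rule inj_onI) blast
  moreover have "(\<lambda>Y. Y - X) ` {Y \<in> nsets U m. X \<subseteq> Y} \<subseteq> nsets (U - X) (m - card X)"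
    using fX by (auto simp: nsets_def card_Diff_subset)
  moreover have "finite (nsets (U - X) (m - card X))"
    using assms by (simp add: finite_imp_finite_nsets)
  ultimately have "card {Y \<in> nsets U m. X \<subseteq> Y} \<le> card (nsets (U - X) (m - card X))"
    using card_inj_on_le by blast
  also have "\<dots> = (card U - card X) choose (m - card X)"
    using assms fX by (simp add: card_nsets card_Diff_subset)
  finally show ?thesis
    using binomial_diff_ratio_le[OF True assms(3)] by linarith
next
  case False
  then have "{Y \<in> nsets U m. X \<subseteq> Y} = {}"
    by (auto simp: nsets_def dest: card_mono)
  then show ?thesis by (simp only: card.empty) simp
qed

text \<open>
  The first-moment method for a random \<open>m\<close>-subset \<open>Y\<close> of \<open>U\<close>: the bound \<open>small\<close> ensures that the
  expected number of members of \<open>\<X>\<close> inside \<open>Y\<close> is below \<open>1\<close>.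
\<close>

lemma ex_nset_avoiding_family:
  fixes U :: "'a set" and \<X> :: "'a set set"
  assumes "finite U" "m \<le> card U" "finite \<X>"
    and \<X>: "\<And>X. X \<in> \<X> \<Longrightarrow> X \<subseteq> U \<and> card X = k"
    and small: "real (card \<X>) * (real m / real (card U)) ^ k < 1"
  obtains Y where "Y \<in> nsets U m" "\<And>X. X \<in> \<X> \<Longrightarrow> \<not> X \<subseteq> Y"
proof -
  let ?B = "real (card U choose m)"
  have B: "?B > 0" using assms(2) by simp
  have "real (card (\<Union>X\<in>\<X>. {Y \<in> nsets U m. X \<subseteq> Y})) \<le> (\<Sum>X\<in>\<X>. real (card {Y \<in> nsets U m. X \<subseteq> Y}))"
    unfolding of_nat_sum[symmetric] of_nat_le_iff by (rule card_UN_le[OF assms(3)])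
  also have "\<dots> \<le> (\<Sum>X\<in>\<X>. ?B * (real m / real (card U)) ^ k)"
  proof (rule sum_mono)
    fix X assume "X \<in> \<X>"
    then have "X \<subseteq> U" "card X = k" using \<X> by auto
    then show "real (card {Y \<in> nsets U m. X \<subseteq> Y}) \<le> ?B * (real m / real (card U)) ^ k"
      using card_nsets_superset_le[OF assms(1) _ assms(2), of X] by simp
  qed
  also have "\<dots> = ?B * (real (card \<X>) * (real m / real (card U)) ^ k)"
    by simp
  also have "\<dots> < ?B * 1"
    using B small by (intro mult_strict_left_mono)
  finally have "card (\<Union>X\<in>\<X>. {Y \<in> nsets U m. X \<subseteq> Y}) < card (nsets U m)"
    using assms(1) by (simp add: card_nsets)
  moreover have "finite (\<Union>X\<in>\<X>. {Y \<in> nsets U m. X \<subseteq> Y})"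
    using assms(1,3) finite_imp_finite_nsets[OF assms(1), of m] by auto
  ultimately have "\<not> nsets U m \<subseteq> (\<Union>X\<in>\<X>. {Y \<in> nsets U m. X \<subseteq> Y})"
    using card_mono leD by blast
  then show thesis using that by blast
qed

section \<open>The edge sets of 1-immersions\<close>

text \<open>
  The edges of a would-be 1-immersion of \<open>K\<^sub>t\<close>, each pair \<open>e\<close> of vertices of \<open>K\<^sub>t\<close> being joined through
  the middle vertex \<open>\<mu> e\<close>.
\<close>

definition spokes :: "nat \<Rightarrow> (nat \<Rightarrow> 'a) \<Rightarrow> (nat set \<Rightarrow> 'a) \<Rightarrow> 'a set set" where
  "spokes t \<phi> \<mu> = (\<Union>e\<in>nsets {..<t} 2. (\<lambda>u. {\<phi> u, \<mu> e}) ` e)"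

text \<open>
  The cardinality condition is what is left of edge-disjointness: \<open>2 * (t choose 2)\<close> is the
  number of edges when none is used twice. Extensional functions are used in order to have finitely
  many choices to count.
\<close>

definition patterns :: "'a set \<Rightarrow> nat \<Rightarrow> 'a set set set" where
  "patterns V t = {X \<in> (\<lambda>(\<phi>, \<mu>). spokes t \<phi> \<mu>) ` (({..<t} \<rightarrow>\<^sub>E V) \<times> (nsets {..<t} 2 \<rightarrow>\<^sub>E V)).
     X \<subseteq> nsets V 2 \<and> card X = 2 * (t choose 2)}"

lemma finite_patterns:
  assumes "finite V"
  shows "finite (patterns V t)"
  unfolding patterns_def using assms by (auto intro!: finite_PiE finite_imp_finite_nsets finite_imageI finite_cartesian_product)

lemma card_patterns_le:
  assumes "finite V"
  shows "card (patterns V t) \<le> card V ^ (t + (t choose 2))"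
proof -
  let ?D = "({..<t} \<rightarrow>\<^sub>E V) \<times> (nsets {..<t} 2 \<rightarrow>\<^sub>E V)"
  have fin: "finite ?D" using assms
    by (auto intro!: finite_PiE finite_imp_finite_nsets finite_cartesian_product)
  have "card (patterns V t) \<le> card ((\<lambda>(\<phi>, \<mu>). spokes t \<phi> \<mu>) ` ?D)"
    unfolding patterns_def using fin by (intro card_mono finite_imageI) blast+
  also have "\<dots> \<le> card ?D" using fin by (rule card_image_le)
  also have "\<dots> = card V ^ (t + (t choose 2))"
    by (simp add: card_cartesian_product card_funcsetE finite_imp_finite_nsets card_nsets power_add)
  finally show ?thesis .
qed

text \<open>
  The vertices of a path are distinct, so the number of its internal vertices determines its length.
\<close>

lemma path_one_internal_vertex:
  assumes "is_path V E p" "card (internal_vertices p) = 1"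
  obtains a m b where "p = [a, m, b]" "distinct [a, m, b]" "{a, m, b} \<subseteq> V"
proof -
  have d: "distinct p" using assms by (simp add: is_path_def)
  then have "length (butlast (tl p)) = 1"
    using assms(2) by (simp add: internal_vertices_def distinct_card distinct_butlast distinct_tl)
  then have "length p = 3" by simp
  then obtain a m b where "p = [a, m, b]"
    by (auto simp: numeral_3_eq_3 length_Suc_conv)
  with d assms(1) show thesis using that by (auto simp: is_path_def)
qed

lemma path_edges_three: "path_edges [a, m, b] = {{a, m}, {m, b}}"
proof -
  have "path_edges [a, m, b] = (\<lambda>i. {[a, m, b] ! i, [a, m, b] ! Suc i}) ` {..<2}"
    by (auto simp: path_edges_def image_def)
  then show ?thesis by (auto simp: numeral_2_eq_2 lessThan_Suc)
qed

text \<open>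
  Restrict the immersion along an injection of \<open>{..<t}\<close> into \<open>W\<close>. The path of an edge \<open>e\<close> then consists
  of the two edges joining the middle vertex to the two elements of \<open>\<phi> ` e\<close>; in this form it does
  not matter from which end the path is listed.
\<close>

lemma one_immersion_contains_pattern:
  assumes "complete_graph W F" "one_immersion W F V E \<phi> P" "t \<le> card W" "simple_graph V E"
  obtains X where "X \<in> patterns V t" "X \<subseteq> E"
proof -
  have finW: "finite W" and F: "F = nsets W 2"
    using assms(1) by (auto simp: complete_graph_def)
  have imm: "\<phi> ` W \<subseteq> V"
      "\<And>e. e \<in> F \<Longrightarrow> is_path V E (P e)"
      "\<And>e. e \<in> F \<Longrightarrow> {hd (P e), last (P e)} = \<phi> ` e"
      "disjoint_family_on (\<lambda>e. path_edges (P e)) F"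
      "\<And>e. e \<in> F \<Longrightarrow> card (internal_vertices (P e)) = 1"
    using assms(2) by (auto simp: one_immersion_def immersion_def)
  have EV: "E \<subseteq> nsets V 2" using assms(4) by (simp add: simple_graph_def)
  have "card {..<t} \<le> card W" using assms(3) by simp
  then obtain f where f: "inj_on f {..<t}" "f ` {..<t} \<subseteq> W"
    using card_le_inj[of "{..<t}" W] finW by auto
  have fe: "f ` e \<in> F" if "e \<in> nsets {..<t} 2" for e
    using that f unfolding F nsets_def by (auto simp: card_image inj_on_subset)
  have "\<exists>m\<in>V. path_edges (P e) = (\<lambda>x. {\<phi> x, m}) ` e \<and> card (path_edges (P e)) = 2"
    if e: "e \<in> F" for e
  proof -
    obtain a m b where p: "P e = [a, m, b]" "distinct [a, m, b]" "{a, m, b} \<subseteq> V"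
      using path_one_internal_vertex[OF imm(2)[OF e] imm(5)[OF e]] .
    have ends: "\<phi> ` e = {a, b}" using imm(3)[OF e] p(1) by simp
    have "path_edges (P e) = (\<lambda>x. {x, m}) ` {a, b}"
      unfolding p(1) path_edges_three by auto
    then have "path_edges (P e) = (\<lambda>x. {\<phi> x, m}) ` e"
      unfolding ends[symmetric] image_image .
    moreover have "card (path_edges (P e)) = 2"
      unfolding p(1) path_edges_three using p(2) by (auto simp: card_insert_if doubleton_eq_iff)
    ultimately show ?thesis using p(3) by auto
  qed
  then obtain mid where mid: "\<And>e. e \<in> F \<Longrightarrow> mid e \<in> V"
      "\<And>e. e \<in> F \<Longrightarrow> path_edges (P e) = (\<lambda>x. {\<phi> x, mid e}) ` e"
      "\<And>e. e \<in> F \<Longrightarrow> card (path_edges (P e)) = 2"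
    by metis
  define \<phi>' where "\<phi>' = restrict (\<phi> \<circ> f) {..<t}"
  define \<mu> where "\<mu> = restrict (\<lambda>e. mid (f ` e)) (nsets {..<t} 2)"
  define X where "X = spokes t \<phi>' \<mu>"
  have "(\<lambda>u. {\<phi>' u, \<mu> e}) ` e = path_edges (P (f ` e))" if e: "e \<in> nsets {..<t} 2" for e
  proof -
    have "e \<subseteq> {..<t}" using e by (simp add: nsets_def)
    then show ?thesis unfolding mid(2)[OF fe[OF e]] image_image \<phi>'_def \<mu>_def
      using e by (intro image_cong) auto
  qed
  then have X: "X = (\<Union>e\<in>nsets {..<t} 2. path_edges (P (f ` e)))"
    unfolding X_def spokes_def by simp
  have XE: "X \<subseteq> E"
    using imm(2)[OF fe] by (auto simp: X is_path_def)
  have "card X = (\<Sum>e\<in>nsets {..<t} 2. card (path_edges (P (f ` e))))"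
    unfolding X
  proof (rule card_UN_disjoint)
    show "finite (nsets {..<t} 2)" by (simp add: finite_imp_finite_nsets)
    show "\<forall>e\<in>nsets {..<t} 2. finite (path_edges (P (f ` e)))"
      using mid(3)[OF fe] by (metis card.infinite zero_neq_numeral)
    show "\<forall>e\<in>nsets {..<t} 2. \<forall>e'\<in>nsets {..<t} 2.
        e \<noteq> e' \<longrightarrow> path_edges (P (f ` e)) \<inter> path_edges (P (f ` e')) = {}"
    proof (intro ballI impI)
      fix e e' assume e: "e \<in> nsets {..<t} 2" "e' \<in> nsets {..<t} 2" "e \<noteq> e'"
      then have "f ` e \<noteq> f ` e'"
        using f(1) by (simp add: nsets_def inj_on_image_eq_iff)
      then show "path_edges (P (f ` e)) \<inter> path_edges (P (f ` e')) = {}"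
        using imm(4) fe e unfolding disjoint_family_on_def by blast
    qed
  qed
  also have "\<dots> = 2 * (t choose 2)" using mid(3)[OF fe] by (simp add: card_nsets)
  finally have "card X = 2 * (t choose 2)" .
  moreover have "\<phi>' \<in> {..<t} \<rightarrow>\<^sub>E V"
    using f(2) imm(1) by (auto simp: \<phi>'_def image_subset_iff)
  moreover have "\<mu> \<in> nsets {..<t} 2 \<rightarrow>\<^sub>E V"
    using mid(1)[OF fe] by (auto simp: \<mu>_def)
  ultimately have "X \<in> patterns V t"
    using XE EV unfolding patterns_def X_def by blast
  then show thesis using that XE by blast
qed

text \<open>
  The union bound is applied with the edges of the complete graph on \<open>V\<close> as ground set: an
  \<open>m\<close>-subset of \<open>nsets V 2\<close> is a graph with \<open>m\<close> edges.
\<close>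

lemma ex_graph_no_large_one_immersion:
  fixes V :: "'a set"
  assumes "finite V" "m \<le> card V choose 2"
    and "real (card V) ^ (t + (t choose 2)) * (real m / real (card V choose 2)) ^ (2 * (t choose 2)) < 1"
  obtains E where "simple_graph V E" "card E = m"
    "\<And>(W :: 'b set) F \<phi> P. complete_graph W F \<Longrightarrow> t \<le> card W \<Longrightarrow> \<not> one_immersion W F V E \<phi> P"
proof -
  have "real (card (patterns V t)) \<le> real (card V) ^ (t + (t choose 2))"
    using card_patterns_le[OF assms(1)] by (metis of_nat_le_iff of_nat_power)
  then have "real (card (patterns V t)) * (real m / real (card V choose 2)) ^ (2 * (t choose 2)) < 1"
    using assms(3) by (meson le_less_trans mult_right_mono zero_le_power divide_nonneg_nonneg of_nat_0_le_iff)
  then obtain E where E: "E \<in> nsets (nsets V 2) m" "\<And>X. X \<in> patterns V t \<Longrightarrow> \<not> X \<subseteq> E"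
    using assms(1,2) finite_patterns[OF assms(1), of t]
    by (elim ex_nset_avoiding_family[where U = "nsets V 2" and m = m and \<X> = "patterns V t"
          and k = "2 * (t choose 2)", rotated -1])
       (auto simp: patterns_def finite_imp_finite_nsets card_nsets)
  have "simple_graph V E" "card E = m"
    using E(1) assms(1) by (auto simp: simple_graph_def nsets_def)
  then show thesis
    using that E(2) one_immersion_contains_pattern by metis
qed

section \<open>The choice of the density\<close>

text \<open>
  The density is taken close to \<open>p = n powr - (1/2 + \<delta>)\<close>. The union bound needs \<open>(t - 1) * \<delta> > 1\<close>,
  so a fixed \<open>\<delta> > 0\<close> allows a fixed \<open>t\<close>. On the other hand \<open>p powr (2 - \<epsilon>) * n\<close> is a power of \<open>n\<close>
  with exponent \<open>\<epsilon>/2 - \<delta> * (2 - \<epsilon>)\<close>, which is at least \<open>\<epsilon>/4\<close> for \<open>\<delta> = \<epsilon>/8\<close>.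
\<close>

lemma ex_density_parameters:
  fixes \<epsilon> :: real and n\<^sub>0 :: int
  assumes "0 < \<epsilon>" "\<epsilon> \<le> 1"
  obtains n m t :: nat where "int n > n\<^sub>0" "m \<le> n choose 2"
    "real n ^ (t + (t choose 2)) * (real m / real (n choose 2)) ^ (2 * (t choose 2)) < 1"
    "real t \<le> (real m / real (n choose 2)) powr (2 - \<epsilon>) * real n"
proof -
  define \<delta> where "\<delta> = \<epsilon> / 8"
  have \<delta>: "0 < \<delta>" "\<delta> \<le> 1/8" using assms by (auto simp: \<delta>_def)
  obtain t :: nat where "1 / \<delta> + 1 < real t" using reals_Archimedean2 ..
  then have t: "1 < (real t - 1) * \<delta>" "1 < real t"
  proof -
    have "1 / \<delta> < real t - 1" using \<open>1 / \<delta> + 1 < real t\<close> by simp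
    then show "1 < (real t - 1) * \<delta>" using \<delta> by (simp add: divide_less_eq)
    have "0 < 1 / \<delta>" using \<delta> by simp
    then show "1 < real t" using \<open>1 / \<delta> < real t - 1\<close> by linarith
  qed
  obtain n :: nat where "max (real_of_int n\<^sub>0) (max 2 ((4 * real t) powr (4/\<epsilon>))) < real n"
    using reals_Archimedean2 ..
  then have n: "int n > n\<^sub>0" "2 \<le> n" "(4 * real t) powr (4/\<epsilon>) \<le> real n" by auto
  \<comment> \<open>The factor 4 pays for rounding: it allows the density to be as small as \<open>p / 2\<close>.\<close>
  have n_big: "4 * real t \<le> real n powr (\<epsilon>/4)"
  proof -
    have "4 * real t = ((4 * real t) powr (4/\<epsilon>)) powr (\<epsilon>/4)"
      using assms(1) t(2) by (simp add: powr_powr)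
    also have "\<dots> \<le> real n powr (\<epsilon>/4)"
      using n(3) assms(1) by (intro powr_mono2) auto
    finally show ?thesis .
  qed
  define N where "N = n choose 2"
  define p where "p = real n powr (- (1/2 + \<delta>))"
  define m where "m = nat \<lfloor>real N * p\<rfloor>"
  have Npos: "0 < N" using n(2) by (simp add: N_def)
  have Nge: "real n ^ 2 / 4 \<le> real N"
  proof -
    have "real N = real n * (real n - 1) / 2"
      using n(2) by (simp add: N_def choose_two real_of_nat_div)
    moreover have "real n / 2 \<le> real n - 1" using n(2) by simp
    then have "real n * (real n / 2) \<le> real n * (real n - 1)" by (intro mult_left_mono) auto
    ultimately show ?thesis by (simp add: power2_eq_square)
  qed
  have p: "0 < p" "p \<le> 1" 
    using n(2) \<delta> powr_mono[of "- (1/2 + \<delta>)" 0 "real n"] by (auto simp: p_def)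
  \<comment> \<open>Rounding a number that is at least 1 down to an integer loses at most a factor 2.\<close>
  have "1 \<le> real N * p"
  proof -
    have "4 \<le> real n powr (\<epsilon>/4)" using n_big t(2) by linarith
    also have "\<dots> \<le> real n powr (2 - (1/2 + \<delta>))"
      using n(2) assms \<delta> by (intro powr_mono) auto
    also have "\<dots> = real n ^ 2 * p"
      using n(2) powr_add[of "real n" 2 "- (1/2 + \<delta>)"] by (simp add: p_def)
    finally have "1 \<le> real n ^ 2 / 4 * p" by simp
    also have "\<dots> \<le> real N * p" using Nge p by (intro mult_right_mono) auto
    finally show ?thesis .
  qed
  then have mfl: "real m \<le> real N * p" "real N * p / 2 \<le> real m"
  proof -
    have fl: "1 \<le> \<lfloor>real N * p\<rfloor>" using \<open>1 \<le> real N * p\<close> by simp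
    then have m_floor: "real m = of_int \<lfloor>real N * p\<rfloor>" by (simp add: m_def)
    show "real m \<le> real N * p" unfolding m_floor by (rule of_int_floor_le)
    have "1 \<le> real m" unfolding m_floor using fl by linarith
    moreover have "real N * p < real m + 1"
      unfolding m_floor by (rule floor_correct[THEN conjunct2, simplified])
    ultimately show "real N * p / 2 \<le> real m" by linarith
  qed
  have mN: "m \<le> N"
  proof -
    have "real N * p \<le> real N" using p by (simp add: mult_left_le)
    then show ?thesis using mfl by linarith
  qed
  define c where "c = real m / real N"
  have c: "0 \<le> c" "c \<le> p" "p / 2 \<le> c"
    using mfl Npos by (auto simp: c_def field_simps)
  let ?k = "t choose 2"
  have k: "real ?k = real t * (real t - 1) / 2"
    using t(2) by (simp add: choose_two real_of_nat_div)
  have "real n ^ (t + ?k) * c ^ (2 * ?k) \<le> real n ^ (t + ?k) * p ^ (2 * ?k)"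
    using c by (intro mult_left_mono power_mono) auto
  also have "\<dots> = real n powr (real t + real ?k - (1/2 + \<delta>) * (2 * real ?k))"
    using n(2) by (simp add: p_def powr_realpow[symmetric] powr_powr powr_add[symmetric] algebra_simps)
  also have "real t + real ?k - (1/2 + \<delta>) * (2 * real ?k) = real t * (1 - (real t - 1) * \<delta>)"
    by (simp add: k field_simps)
  also have "real n powr \<dots> < 1"
    using n(2) t by (simp add: powr_less_one mult_pos_neg)
  finally have unlikely: "real n ^ (t + ?k) * c ^ (2 * ?k) < 1" .
  have "real t \<le> real n powr (\<epsilon>/4) / 4" using n_big by simp
  also have "\<dots> \<le> real n powr (1 - (1/2 + \<delta>) * (2 - \<epsilon>)) / 4"
  proof -
    have "\<epsilon>/4 \<le> 1 - (1/2 + \<delta>) * (2 - \<epsilon>)"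
      using assms by (simp add: \<delta>_def field_simps)
    then show ?thesis using n(2) by (simp add: powr_mono)
  qed
  also have "\<dots> = p powr (2 - \<epsilon>) * real n / 4"
  proof -
    have "1 - (1/2 + \<delta>) * (2 - \<epsilon>) = - (1/2 + \<delta>) * (2 - \<epsilon>) + 1" by (simp add: algebra_simps)
    then show ?thesis using n(2) by (simp only: p_def powr_powr powr_add) simp
  qed
  also have "\<dots> \<le> (p / 2) powr (2 - \<epsilon>) * real n"
  proof -
    have "2 powr (2 - \<epsilon>) \<le> (2::real) powr 2" using assms by (intro powr_mono) auto
    then have "p powr (2 - \<epsilon>) / 4 \<le> p powr (2 - \<epsilon>) / 2 powr (2 - \<epsilon>)"
      by (intro divide_left_mono) auto
    also have "\<dots> = (p / 2) powr (2 - \<epsilon>)"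
      using p by (simp add: powr_divide)
    finally have "p powr (2 - \<epsilon>) / 4 * real n \<le> (p / 2) powr (2 - \<epsilon>) * real n"
      by (rule mult_right_mono) simp
    then show ?thesis by simp
  qed
  also have "\<dots> \<le> c powr (2 - \<epsilon>) * real n"
    using c p assms by (intro mult_right_mono powr_mono2) auto
  finally have "real t \<le> c powr (2 - \<epsilon>) * real n" .
  with unlikely mN n(1) show thesis
    using that[of n m t] by (auto simp: c_def N_def)
qed

section \<open>Graphs without large 1-immersions of complete graphs\<close>

text \<open>
  As the density is at most \<open>1\<close>, the bound \<open>c powr (2 - \<epsilon>) * n\<close> increases with \<open>\<epsilon>\<close>, so it suffices
  to treat \<open>\<epsilon> \<le> 1\<close>.
\<close>

theorem proposition4p2:
  fixes \<epsilon> :: real and n\<^sub>0 :: int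
  assumes "\<epsilon> > 0"
  shows "\<exists>(V :: nat set) E. simple_graph V E \<and> int (card V) > n\<^sub>0 \<and>
    \<not> (\<exists>(W :: nat set) F \<phi> P. complete_graph W F \<and>
          real (card W) \<ge> edge_density V E powr (2 - \<epsilon>) * real (card V) \<and>
          one_immersion W F V E \<phi> P)"
proof -
  define \<eta> where "\<eta> = min \<epsilon> 1"
  have \<eta>: "0 < \<eta>" "\<eta> \<le> 1" "\<eta> \<le> \<epsilon>" using assms by (auto simp: \<eta>_def)
  obtain n m t where par: "int n > n\<^sub>0" "m \<le> n choose 2"
    "real n ^ (t + (t choose 2)) * (real m / real (n choose 2)) ^ (2 * (t choose 2)) < 1"
    "real t \<le> (real m / real (n choose 2)) powr (2 - \<eta>) * real n"
    using ex_density_parameters[OF \<eta>(1,2)] .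
  let ?V = "{..<n}"
  obtain E where E: "simple_graph ?V E" "card E = m"
    "\<And>(W :: nat set) F \<phi> P. complete_graph W F \<Longrightarrow> t \<le> card W \<Longrightarrow> \<not> one_immersion W F ?V E \<phi> P"
    using ex_graph_no_large_one_immersion[of ?V m t] par by auto
  let ?c = "edge_density ?V E"
  have c: "?c = real m / real (n choose 2)" using E(2) by (simp add: edge_density_def)
  have "0 \<le> ?c" "?c \<le> 1" using par(2) by (auto simp: c divide_le_eq_1)
  then have "?c powr (2 - \<eta>) \<le> ?c powr (2 - \<epsilon>)"
    using \<eta>(3) by (intro powr_mono') auto
  then have "real t \<le> ?c powr (2 - \<epsilon>) * real n"
    using par(4) unfolding c by (meson mult_right_mono of_nat_0_le_iff order_trans)
  then have "t \<le> card W" if "real (card W) \<ge> ?c powr (2 - \<epsilon>) * real (card ?V)" for W :: "nat set"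
    using that by simp
  then show ?thesis using E(1,3) par(1)
    by (intro exI[of _ ?V] exI[of _ E]) auto
qed

end
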